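(* Let $G$ be a second countable locally compact group and $H$ be a closed subgroup of finite covolume. Then the $G$-action on $G/H$, equipped with its $G$-invariant probability measure, is strongly ergodic. In other words, every continuous, transitive, probability measure preserving action of a second countable locally compact group is strongly ergodic.
   Context: A closed subgroup $H$ of a locally compact group $G$ is of finite covolume if $G/H$ carries a $G$-invariant probability measure. A probability measure preserving action of $G$ on a space $(X,m)$ is strongly ergodic if for every sequence $(B_n)$ of measurable subsets of $X$ with $\lim_n m(B_n\,\Delta\, gB_n)=0$ for all $g\in G$, one has $\lim_n m(B_n)(1-m(B_n))=0$. *)

theory Defs
  imports "HOL-Probability.Probability"
begin

text \<open>
  Topological groups are types of class \<open>topological_group_add\<close>. The group operation is written
  additively but is not assumed to be commutative; topological groups and spaces on which they act
  are Hausdorff, as usual for locally compact groups.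
\<close>

definition add_subgroup :: "'g::group_add set \<Rightarrow> bool" where
  "add_subgroup H \<longleftrightarrow> 0 \<in> H \<and> (\<forall>x\<in>H. \<forall>y\<in>H. x + y \<in> H) \<and> (\<forall>x\<in>H. - x \<in> H)"

definition left_coset :: "'g::group_add set \<Rightarrow> 'g \<Rightarrow> 'g set" where
  "left_coset H g = (\<lambda>h. g + h) ` H"

definition coset_space :: "'g::{group_add,topological_space} set \<Rightarrow> 'g set topology" where
  "coset_space H = topology (\<lambda>\<U>. \<U> \<subseteq> range (left_coset H) \<and> open (left_coset H -` \<U>))"

lemma openin_coset_space:
  "openin (coset_space H) \<U> \<longleftrightarrow> \<U> \<subseteq> range (left_coset H) \<and> open (left_coset H -` \<U>)"
proof -
  have "istopology (\<lambda>\<U>. \<U> \<subseteq> range (left_coset H) \<and> open (left_coset H -` \<U>))"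
    unfolding istopology_def by (auto simp: vimage_Union)
  then show ?thesis
    by (simp add: coset_space_def)
qed

lemma topspace_coset_space: "topspace (coset_space H) = range (left_coset H)"
proof -
  have "left_coset H -` range (left_coset H) = UNIV"
    by auto
  then have "openin (coset_space H) (range (left_coset H))"
    by (simp add: openin_coset_space)
  then show ?thesis
    by (metis openin_coset_space openin_subset openin_topspace subset_antisym)
qed

lemma quotient_map_coset_space: "quotient_map euclidean (coset_space H) (left_coset H)"
  unfolding quotient_map_def
  by (auto simp: topspace_coset_space openin_coset_space vimage_def)

definition translate :: "'g::group_add \<Rightarrow> 'g set \<Rightarrow> 'g set" where
  "translate g C = (\<lambda>x. g + x) ` C"

definition acts_on :: "('g::group_add \<Rightarrow> 'x \<Rightarrow> 'x) \<Rightarrow> 'x set \<Rightarrow> bool" where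
  "acts_on \<alpha> S \<longleftrightarrow>
     (\<forall>g. \<forall>x\<in>S. \<alpha> g x \<in> S) \<and>
     (\<forall>x\<in>S. \<alpha> 0 x = x) \<and>
     (\<forall>g h. \<forall>x\<in>S. \<alpha> (g + h) x = \<alpha> g (\<alpha> h x))"

lemma acts_on_translate: "acts_on translate (range (left_coset H))"
  by (auto simp: acts_on_def translate_def left_coset_def image_image add.assoc[symmetric])

definition transitive_on :: "('g \<Rightarrow> 'x \<Rightarrow> 'x) \<Rightarrow> 'x set \<Rightarrow> bool" where
  "transitive_on \<alpha> S \<longleftrightarrow> (\<forall>x\<in>S. \<forall>y\<in>S. \<exists>g. \<alpha> g x = y)"

definition continuous_action ::
    "('g::{group_add,topological_space} \<Rightarrow> 'x \<Rightarrow> 'x) \<Rightarrow> 'x topology \<Rightarrow> bool" where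
  "continuous_action \<alpha> X \<longleftrightarrow>
     acts_on \<alpha> (topspace X) \<and>
     continuous_map (prod_topology euclidean X) X (\<lambda>(g, x). \<alpha> g x)"

definition borel_of :: "'x topology \<Rightarrow> 'x measure" where
  "borel_of X = sigma (topspace X) {U. openin X U}"

definition invariant_borel_prob ::
    "('g \<Rightarrow> 'x \<Rightarrow> 'x) \<Rightarrow> 'x topology \<Rightarrow> 'x measure \<Rightarrow> bool" where
  "invariant_borel_prob \<alpha> X m \<longleftrightarrow>
     prob_space m \<and> sets m = sets (borel_of X) \<and>
     (\<forall>g. \<alpha> g \<in> m \<rightarrow>\<^sub>M m \<and> distr m m (\<alpha> g) = m)"

definition finite_covolume :: "'g::{group_add,topological_space} set \<Rightarrow> bool" where
  "finite_covolume H \<longleftrightarrow> (\<exists>m. invariant_borel_prob translate (coset_space H) m)"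

definition strongly_ergodic :: "('g \<Rightarrow> 'x \<Rightarrow> 'x) \<Rightarrow> 'x measure \<Rightarrow> bool" where
  "strongly_ergodic \<alpha> m \<longleftrightarrow>
     (\<forall>B :: nat \<Rightarrow> 'x set.
        (\<forall>n. B n \<in> sets m) \<longrightarrow>
        (\<forall>g. (\<lambda>n. measure m (sym_diff (B n) (\<alpha> g ` B n))) \<longlonglongrightarrow> 0) \<longrightarrow>
        (\<lambda>n. measure m (B n) * (1 - measure m (B n))) \<longlonglongrightarrow> 0)"

end

theory Submission
  imports Defs
begin

text \<open>
  Let \<open>\<nu>\<close> be a finite measure on the group \<open>G\<close> with the null sets of a right Haar measure, and draw
  \<open>x\<close> from \<open>m\<close> and \<open>g\<close> from \<open>\<nu>\<close> independently. The law \<open>\<pi>\<close> of the pair \<open>(x, g x)\<close> is compared with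
  the product \<open>m \<times> m\<close> in two ways.

  First, almost invariance makes rectangles small for \<open>\<pi>\<close>. The \<open>\<pi>\<close>-measure of \<open>B\<^sub>n \<times> (X - B\<^sub>n)\<close> is the
  average over \<open>g\<close> of the measure of those points of \<open>B\<^sub>n\<close> that \<open>g\<close> moves out of \<open>B\<^sub>n\<close>. Each
  of these measures tends to \<open>0\<close>, hence so does the average, by dominated convergence
  (\<open>coupling_rectangle_tendsto_0\<close>).

  Second, transitivity makes \<open>m \<times> m\<close> absolutely continuous with respect to \<open>\<pi>\<close>
  (\<open>product_absolutely_continuous\<close>). If \<open>g x\<close> avoids a set \<open>E\<close> for almost every \<open>g\<close>, then by right
  quasi-invariance of \<open>\<nu>\<close> the same is true of every point of the orbit of \<open>x\<close>, that is, of every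
  point of \<open>X\<close>; by Fubini some single \<open>g\<close> moves almost every point off \<open>E\<close>, and invariance of \<open>m\<close>
  gives \<open>m(E) = 0\<close>.

  Since both measures are finite, the two facts together yield
  \<open>m(B\<^sub>n) (1 - m(B\<^sub>n)) = (m \<times> m)(B\<^sub>n \<times> (X - B\<^sub>n)) \<longrightarrow> 0\<close>. This covers coset spaces and general
  transitive actions alike; for the former it only has to be seen that translation is continuous
  and transitive.

  Two ingredients need work. A right Haar measure is constructed by Weil's method: normalised
  covering numbers by translates of shrinking neighbourhoods have a limit point, which is a
  content on compact sets, and Caratheodory's theorem turns the content into a Borel measure
  (\<open>exists_right_haar_measure\<close>). The other ingredient is joint measurability of the action with respect to the product of the two
  Borel \<open>\<sigma>\<close>-algebras although \<open>X\<close> need not be second countable; it holds because \<open>X\<close> is a continuous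
  image of \<open>G\<close>, so that open subsets of \<open>X \<times> G\<close> are countable unions of open rectangles
  (\<open>continuous_action_joint_measurable\<close>).
\<close>

section \<open>Right translates and covering numbers\<close>

definition right_translate :: "'g::group_add \<Rightarrow> 'g set \<Rightarrow> 'g set" where
  "right_translate g A = (\<lambda>x. x + g) ` A"

lemma right_translate_mono: "A \<subseteq> B \<Longrightarrow> right_translate g A \<subseteq> right_translate g B"
  by (auto simp: right_translate_def)

lemma right_translate_add: "right_translate h (right_translate g A) = right_translate (g + h) A"
  by (auto simp: right_translate_def image_image add.assoc)

lemma right_translate_inverse [simp]: "right_translate (- g) (right_translate g A) = A"
  "right_translate g (right_translate (- g) A) = A"
  by (auto simp: right_translate_add) (auto simp: right_translate_def)

lemma mem_right_translate: "x \<in> right_translate g A \<longleftrightarrow> x - g \<in> A"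
  by (force simp: right_translate_def image_iff)

lemma right_translate_eq_vimage: "right_translate g A = (\<lambda>x. x - g) -` A"
  by (auto simp: mem_right_translate)

lemma compact_right_translate:
  fixes A :: "'g::topological_group_add set"
  assumes "compact A"
  shows "compact (right_translate g A)"
  unfolding right_translate_def by (intro compact_continuous_image continuous_intros assms)

lemma open_right_translate:
  fixes A :: "'g::topological_group_add set"
  assumes "open A"
  shows "open (right_translate g A)"
  unfolding right_translate_eq_vimage by (intro open_vimage assms continuous_intros)

definition covers :: "'g::group_add set \<Rightarrow> 'g set \<Rightarrow> 'g set \<Rightarrow> bool" where
  "covers V A F \<longleftrightarrow> finite F \<and> A \<subseteq> (\<Union>g\<in>F. right_translate g V)"

definition covering_number :: "'g::group_add set \<Rightarrow> 'g set \<Rightarrow> nat" where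
  "covering_number V A = Inf (card ` {F. covers V A F})"

lemma covering_number_le: "covers V A F \<Longrightarrow> covering_number V A \<le> card F"
  unfolding covering_number_def by (rule cInf_lower) auto

lemma exists_minimal_cover:
  fixes A :: "'g::topological_group_add set"
  assumes "compact A" "open V" "0 \<in> V"
  obtains F where "covers V A F" "card F = covering_number V A"
proof -
  have "\<exists>F. covers V A F"
  proof -
    have "A \<subseteq> (\<Union>g\<in>A. right_translate g V)"
      using \<open>0 \<in> V\<close> by (auto simp: mem_right_translate)
    then obtain F where "F \<subseteq> A" "finite F" "A \<subseteq> (\<Union>g\<in>F. right_translate g V)"
      using compactE_image[OF \<open>compact A\<close>, of A "\<lambda>g. right_translate g V"]
        open_right_translate[OF \<open>open V\<close>] by metis
    then show ?thesis
      by (auto simp: covers_def)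
  qed
  then have "card ` {F. covers V A F} \<noteq> {}"
    by auto
  from Inf_nat_def1[OF this] show ?thesis
    using that unfolding covering_number_def by auto
qed

lemma covering_number_mono:
  fixes B :: "'g::topological_group_add set"
  assumes "compact B" "open V" "0 \<in> V" "A \<subseteq> B"
  shows "covering_number V A \<le> covering_number V B"
proof -
  obtain F where "covers V B F" "card F = covering_number V B"
    using exists_minimal_cover[OF assms(1-3)] .
  then show ?thesis
    using covering_number_le[of V A F] \<open>A \<subseteq> B\<close> by (auto simp: covers_def)
qed

lemma covering_number_Un_le:
  fixes A :: "'g::topological_group_add set"
  assumes "compact A" "compact B" "open V" "0 \<in> V"
  shows "covering_number V (A \<union> B) \<le> covering_number V A + covering_number V B"
proof -
  obtain F where F: "covers V A F" "card F = covering_number V A"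
    using exists_minimal_cover[OF assms(1,3,4)] .
  obtain E where E: "covers V B E" "card E = covering_number V B"
    using exists_minimal_cover[OF assms(2,3,4)] .
  have "covers V (A \<union> B) (F \<union> E)"
    using F E by (auto simp: covers_def)
  then show ?thesis
    using covering_number_le card_Un_le[of F E] F(2) E(2) by (metis order_trans)
qed

text \<open>
  Additivity holds up to the translates that meet both sets: a minimal cover of the union splits
  into a cover of \<open>A\<close> and a cover of \<open>B\<close> when there are none. For disjoint compact sets this is the
  case once \<open>V\<close> is small enough.
\<close>

lemma covering_number_Un_ge:
  fixes A :: "'g::topological_group_add set"
  assumes "compact A" "compact B" "open V" "0 \<in> V"
    and sep: "\<And>g. right_translate g V \<inter> A = {} \<or> right_translate g V \<inter> B = {}"
  shows "covering_number V A + covering_number V B \<le> covering_number V (A \<union> B)"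
proof -
  obtain F where F: "covers V (A \<union> B) F" "card F = covering_number V (A \<union> B)"
    using exists_minimal_cover[OF compact_Un[OF assms(1,2)] assms(3,4)] .
  define E where "E = {g\<in>F. right_translate g V \<inter> A \<noteq> {}}"
  have "finite F" using F by (auto simp: covers_def)
  have "covers V A E"
    using F(1) unfolding covers_def E_def by fastforce
  moreover have "covers V B (F - E)"
    using F(1) sep unfolding covers_def E_def by fastforce
  ultimately have "covering_number V A + covering_number V B \<le> card E + card (F - E)"
    by (intro add_mono covering_number_le)
  also have "\<dots> = card F"
    using \<open>finite F\<close> by (simp add: E_def card_Diff_subset card_mono)
  finally show ?thesis using F(2) by simp
qed

lemma covering_number_translate_le:
  fixes A :: "'g::topological_group_add set"
  assumes "compact A" "open V" "0 \<in> V"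
  shows "covering_number V (right_translate g A) \<le> covering_number V A"
proof -
  obtain F where F: "covers V A F" "card F = covering_number V A"
    using exists_minimal_cover[OF assms] .
  have "right_translate g A \<subseteq> right_translate g (\<Union>f\<in>F. right_translate f V)"
    using F(1) by (intro right_translate_mono) (auto simp: covers_def)
  also have "\<dots> = (\<Union>f\<in>F. right_translate (f + g) V)"
    unfolding right_translate_add[symmetric] by (auto simp: right_translate_def)
  finally have "covers V (right_translate g A) ((\<lambda>f. f + g) ` F)"
    using F(1) by (auto simp: covers_def)
  then show ?thesis
    using covering_number_le F card_image_le[of F "\<lambda>f. f + g"]
    by (metis covers_def order_trans)
qed

lemma covering_number_translate:
  fixes A :: "'g::topological_group_add set"
  assumes "compact A" "open V" "0 \<in> V"
  shows "covering_number V (right_translate g A) = covering_number V A"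
  using covering_number_translate_le[OF assms, of g]
    covering_number_translate_le[OF compact_right_translate[OF assms(1)] assms(2,3), of "- g" g]
  by simp

text \<open>
  Covering each of the translates of \<open>W\<close> that cover \<open>A\<close> by translates of \<open>V\<close> bounds the ratio of the
  covering numbers of \<open>A\<close> and \<open>K\<close> by a quantity independent of \<open>V\<close>. This is what makes the
  normalised covering numbers relatively compact.
\<close>

lemma covering_number_submult:
  fixes A :: "'g::topological_group_add set"
  assumes "compact A" "compact K" "open V" "0 \<in> V" "open W" "0 \<in> W" "W \<subseteq> K"
  shows "covering_number V A \<le> covering_number W A * covering_number V K"
proof -
  obtain F where F: "covers W A F" "card F = covering_number W A"
    using exists_minimal_cover[OF assms(1,5,6)] .
  obtain E where E: "covers V K E" "card E = covering_number V K"
    using exists_minimal_cover[OF assms(2-4)] .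
  have fin: "finite F" "finite E" using F E by (auto simp: covers_def)
  let ?S = "(\<lambda>(f, e). e + f) ` (F \<times> E)"
  have "A \<subseteq> (\<Union>f\<in>F. right_translate f W)"
    using F(1) by (simp add: covers_def)
  also have "\<dots> \<subseteq> (\<Union>f\<in>F. right_translate f (\<Union>e\<in>E. right_translate e V))"
    using E(1) \<open>W \<subseteq> K\<close> by (intro UN_mono order_refl right_translate_mono) (auto simp: covers_def)
  also have "\<dots> = (\<Union>f\<in>F. \<Union>e\<in>E. right_translate (e + f) V)"
    unfolding right_translate_add[symmetric] by (auto simp: right_translate_def)
  also have "\<dots> = (\<Union>s\<in>?S. right_translate s V)"
    by auto
  finally have "covers V A ?S"
    using fin by (simp add: covers_def)
  then have "covering_number V A \<le> card ?S"
    by (rule covering_number_le)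
  also have "\<dots> \<le> card (F \<times> E)"
    using fin by (intro card_image_le) auto
  finally show ?thesis
    using F(2) E(2) by (simp add: card_cartesian_product)
qed

lemma covering_number_pos:
  fixes A :: "'g::topological_group_add set"
  assumes "compact A" "open V" "0 \<in> V" "A \<noteq> {}"
  shows "0 < covering_number V A"
proof -
  obtain F where "covers V A F" "card F = covering_number V A"
    using exists_minimal_cover[OF assms(1-3)] .
  then show ?thesis using \<open>A \<noteq> {}\<close> by (cases "F = {}") (auto simp: covers_def card_gt_0_iff)
qed

section \<open>A translation-invariant content on compact sets\<close>

text \<open>
  Tychonoff's theorem for a product of compact intervals. Refining the filter replaces the choice of
  a convergent subsequence, which need not exist when the index type is uncountable, and lets
  algebraic relations pass to the limit by the usual \<open>tendsto\<close> rules.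
\<close>

lemma bounded_family_converges_along_filter:
  fixes h :: "nat \<Rightarrow> 'i \<Rightarrow> real"
  assumes "\<And>n i. 0 \<le> h n i" "\<And>n i. h n i \<le> B i"
  obtains F L where "F \<noteq> bot" "F \<le> sequentially" "\<And>i. ((\<lambda>n. h n i) \<longlongrightarrow> L i) F"
proof -
  let ?S = "PiE UNIV (\<lambda>i. {0..B i})"
  have "compactin (product_topology (\<lambda>i. euclidean) UNIV) ?S"
    by (subst compactin_PiE) auto
  then have "compact ?S"
    by (simp add: euclidean_product_topology)
  moreover have "filtermap h sequentially \<noteq> bot"
    by (simp add: filtermap_bot_iff)
  moreover have "eventually (\<lambda>x. x \<in> ?S) (filtermap h sequentially)"
    using assms by (simp add: eventually_filtermap PiE_def Pi_def)
  ultimately obtain L where L: "inf (nhds L) (filtermap h sequentially) \<noteq> bot"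
    unfolding compact_filter by blast
  define F where "F = inf sequentially (filtercomap h (nhds L))"
  have "F \<noteq> bot"
  proof
    assume "F = bot"
    then have "eventually (\<lambda>_. False) F"
      by simp
    then obtain P Q where PQ: "eventually P sequentially" "eventually Q (nhds L)" "\<And>n. P n \<Longrightarrow> Q (h n) \<Longrightarrow> False"
      unfolding F_def eventually_inf eventually_filtercomap by (metis)
    have "eventually (\<lambda>_. False) (inf (nhds L) (filtermap h sequentially))"
      unfolding eventually_inf eventually_filtermap
      by (rule exI[of _ Q], rule exI[of _ "\<lambda>x. \<not> Q x"])
        (use PQ(2) in \<open>auto intro: eventually_mono[OF PQ(1)] dest: PQ(3)\<close>)
    with L show False by (simp add: trivial_limit_def)
  qed
  moreover have "F \<le> sequentially"
    by (simp add: F_def)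
  moreover have "((\<lambda>n. h n i) \<longlongrightarrow> L i) F" for i
  proof -
    have "filterlim h (nhds L) F"
      unfolding F_def by (metis filterlim_filtercomap filterlim_mono inf_le2 order_refl)
    then have "\<forall>\<^sub>F n in F. h n \<in> (\<lambda>f. f i) -` S" if "open S" "L i \<in> S" for S
      using that open_vimage[OF _ continuous_on_product_coordinates, of S i]
      by (auto dest!: topological_tendstoD)
    then show ?thesis
      by (auto intro!: topological_tendstoI)
  qed
  ultimately show ?thesis using that by blast
qed

section \<open>From contents to Borel measures\<close>

lemma Hausdorff_space_euclidean_t2: "Hausdorff_space (euclidean :: 'a::t2_space topology)"
  unfolding Hausdorff_space_def using hausdorff by (auto simp: disjnt_def)

locale compact_content =
  fixes h :: "'a::t2_space set \<Rightarrow> real"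
  assumes nonneg: "0 \<le> h C"
    and mono: "compact C \<Longrightarrow> compact D \<Longrightarrow> C \<subseteq> D \<Longrightarrow> h C \<le> h D"
    and subadditive: "compact C \<Longrightarrow> compact D \<Longrightarrow> h (C \<union> D) \<le> h C + h D"
    and additive: "compact C \<Longrightarrow> compact D \<Longrightarrow> C \<inter> D = {} \<Longrightarrow> h (C \<union> D) = h C + h D"

text \<open>
  If a right translate of \<open>V\<close> contained both \<open>c \<in> C\<close> and \<open>d \<in> D\<close>, then \<open>c - d\<close> would be a
  difference of two elements of \<open>V\<close>. The differences \<open>c - d\<close> form a compact set that misses \<open>0\<close>, so
  small \<open>V\<close> are excluded by continuity of subtraction.
\<close>

lemma eventually_no_translate_meets_both:
  fixes C D :: "'g::{topological_group_add,t2_space} set" and V :: "nat \<Rightarrow> 'g set"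
  assumes V: "\<And>S. open S \<Longrightarrow> 0 \<in> S \<Longrightarrow> \<forall>\<^sub>F n in sequentially. V n \<subseteq> S"
    and "compact C" "compact D" "C \<inter> D = {}"
  shows "\<forall>\<^sub>F n in sequentially. \<forall>g. right_translate g (V n) \<inter> C = {} \<or> right_translate g (V n) \<inter> D = {}"
proof -
  let ?P = "(\<lambda>(c, d). c - d) ` (C \<times> D)"
  have "compact ?P"
    unfolding case_prod_beta
    by (intro compact_continuous_image continuous_intros compact_Times assms)
  then have "open (- ?P)"
    by (intro open_Compl compact_imp_closed)
  have "continuous_on UNIV (\<lambda>p::'g \<times> 'g. fst p - snd p)"
    by (intro continuous_intros)
  then have "open ((\<lambda>p. fst p - snd p) -` (- ?P))"
    using \<open>open (- ?P)\<close> by (metis open_vimage)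
  moreover have "(0, 0) \<in> (\<lambda>p. fst p - snd p) -` (- ?P)"
    using \<open>C \<inter> D = {}\<close> by auto
  ultimately obtain A B where AB: "open A" "open B" "(0, 0) \<in> A \<times> B"
    "A \<times> B \<subseteq> (\<lambda>p. fst p - snd p) -` (- ?P)"
    by (rule open_prod_elim)
  then have "\<forall>\<^sub>F n in sequentially. V n \<subseteq> A \<inter> B"
    by (intro V) auto
  then show ?thesis
  proof (rule eventually_mono)
    fix n assume n: "V n \<subseteq> A \<inter> B"
    show "\<forall>g. right_translate g (V n) \<inter> C = {} \<or> right_translate g (V n) \<inter> D = {}"
    proof (intro allI, rule ccontr)
      fix g
      assume "\<not> (right_translate g (V n) \<inter> C = {} \<or> right_translate g (V n) \<inter> D = {})"
      then obtain c d where cd: "c \<in> C" "d \<in> D" "c - g \<in> V n" "d - g \<in> V n"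
        by (auto simp: mem_right_translate)
      then have "(c - g, d - g) \<in> A \<times> B" using n by auto
      then have "(c - g, d - g) \<in> (\<lambda>p. fst p - snd p) -` (- ?P)"
        by (rule subsetD[OF AB(4)])
      then have "(c - g) - (d - g) \<in> - ?P"
        by (simp only: vimage_eq fst_conv snd_conv)
      moreover have "(c - g) - (d - g) = c - d"
        by (simp add: diff_conv_add_uminus minus_add add.assoc del: add_uminus_conv_diff)
      ultimately show False using cd by auto
    qed
  qed
qed

text \<open>
  The content is a limit of covering numbers relative to a fixed compact neighbourhood \<open>K\<close> of \<open>0\<close>, taken
  along a filter on which all the ratios converge at once. The normalisation \<open>h K = 1\<close> keeps the
  resulting measure from vanishing, and the open set \<open>W\<close> inside \<open>K\<close> will have finite measure.
\<close>

lemma exists_haar_content: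
  assumes "locally_compact_space
             (euclidean :: 'g::{topological_group_add,t2_space,first_countable_topology} topology)"
  obtains h :: "'g::{topological_group_add,t2_space,first_countable_topology} set \<Rightarrow> real" and K W where
    "compact_content h" "\<And>g C. compact C \<Longrightarrow> h (right_translate g C) = h C"
    "compact K" "open W" "0 \<in> W" "W \<subseteq> K" "h K = 1"
proof -
  obtain W K :: "'g set" where WK: "open W" "compact K" "0 \<in> W" "W \<subseteq> K"
    using assms unfolding locally_compact_space_def
    by (metis UNIV_I compactin_euclidean_iff open_openin topspace_euclidean)
  obtain V :: "nat \<Rightarrow> 'g set" where V: "\<And>n. open (V n)" "\<And>n. 0 \<in> V n"
    and V_small: "\<And>S. open S \<Longrightarrow> 0 \<in> S \<Longrightarrow> \<forall>\<^sub>F n in sequentially. V n \<subseteq> S"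
    using countable_basis_at_decseq[of 0] by metis
  define c where "c n A = real (covering_number (V n) A) / real (covering_number (V n) K)" for n A
  \<comment> \<open>Only compact sets are sure to have a finite cover; the value \<open>0\<close> elsewhere keeps the
    family bounded by \<open>covering_number W A\<close>.\<close>
  define h where "h n A = (if compact A then c n A else 0)" for n A
  have posK: "0 < covering_number (V n) K" for n
    using WK V by (intro covering_number_pos) auto
  have "0 \<le> h n A" for n A
    by (auto simp: h_def c_def)
  moreover have "h n A \<le> real (covering_number W A)" for n A
  proof (cases "compact A")
    case True
    then have "covering_number (V n) A \<le> covering_number W A * covering_number (V n) K"
      using WK V by (intro covering_number_submult) auto
    then have "real (covering_number (V n) A) \<le> real (covering_number W A) * real (covering_number (V n) K)"
      by (metis of_nat_le_iff of_nat_mult)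
    then show ?thesis
      using True posK[of n] by (simp add: h_def c_def divide_le_eq)
  qed (simp add: h_def)
  ultimately obtain F L where F: "F \<noteq> bot" "F \<le> sequentially"
    and lim: "\<And>A. ((\<lambda>n. h n A) \<longlongrightarrow> L A) F"
    using bounded_family_converges_along_filter[of h "\<lambda>A. real (covering_number W A)"] by metis
  have content: "compact_content L"
  proof
    show "0 \<le> L C" for C
      using F lim by (intro tendsto_lowerbound[OF lim]) (auto simp: h_def c_def)
  next
    fix C D :: "'g set" assume "compact C" "compact D" "C \<subseteq> D"
    have "h n C \<le> h n D" for n
      using \<open>compact C\<close> \<open>compact D\<close> \<open>C \<subseteq> D\<close> V
      by (simp add: h_def c_def divide_right_mono covering_number_mono)
    then show "L C \<le> L D"
      using F by (intro tendsto_le[OF _ lim lim]) auto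
  next
    fix C D :: "'g set" assume CD: "compact C" "compact D"
    have le: "h n (C \<union> D) \<le> h n C + h n D" for n
      using CD V covering_number_Un_le[of C D "V n"]
      by (simp add: h_def c_def compact_Un flip: add_divide_distrib of_nat_add)
         (intro divide_right_mono, auto)
    show "L (C \<union> D) \<le> L C + L D"
      using F le by (intro tendsto_le[OF _ tendsto_add[OF lim lim] lim]) auto
    assume "C \<inter> D = {}"
    then have "\<forall>\<^sub>F n in sequentially. \<forall>g. right_translate g (V n) \<inter> C = {} \<or> right_translate g (V n) \<inter> D = {}"
      using CD V_small by (intro eventually_no_translate_meets_both)
    then have "\<forall>\<^sub>F n in sequentially. h n (C \<union> D) = h n C + h n D"
    proof (rule eventually_mono)
      fix n assume "\<forall>g. right_translate g (V n) \<inter> C = {} \<or> right_translate g (V n) \<inter> D = {}"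
      then have "covering_number (V n) (C \<union> D) = covering_number (V n) C + covering_number (V n) D"
        using CD V by (intro antisym covering_number_Un_le covering_number_Un_ge) auto
      then show "h n (C \<union> D) = h n C + h n D"
        using CD by (simp add: h_def c_def compact_Un add_divide_distrib)
    qed
    then have "\<forall>\<^sub>F n in F. h n (C \<union> D) = h n C + h n D"
      using F(2) by (simp add: filter_leD)
    then have "((\<lambda>n. h n C + h n D) \<longlongrightarrow> L (C \<union> D)) F"
      by (rule Lim_transform_eventually[OF lim])
    then show "L (C \<union> D) = L C + L D"
      using tendsto_unique[OF F(1) _ tendsto_add[OF lim lim]] by blast
  qed
  have "L (right_translate g C) = L C" if "compact C" for g C
  proof -
    have "h n (right_translate g C) = h n C" for n
      using that V by (simp add: h_def c_def compact_right_translate covering_number_translate)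
    then have "((\<lambda>n. h n C) \<longlongrightarrow> L (right_translate g C)) F"
      using lim[of "right_translate g C"] by simp
    then show ?thesis
      using F(1) lim tendsto_unique by blast
  qed
  moreover have "L K = 1"
  proof -
    have "h n K = 1" for n
      using WK posK[of n] by (simp add: h_def c_def)
    then show ?thesis
      using F(1) lim[of K] by (simp add: tendsto_const_iff)
  qed
  ultimately show ?thesis
    using that[OF content] WK by blast
qed

context compact_content
begin

lemma empty [simp]: "h {} = 0"
  using additive[of "{}" "{}"] by simp

text \<open>
  The content is first extended to open sets from inside and then to all sets from outside. Passing
  through open sets makes the extension countably subadditive, because a compact subset of a
  countable union of open sets is covered by finitely many of them.
\<close>

definition inner_content :: "'a set \<Rightarrow> ennreal" where
  "inner_content U = (SUP C\<in>{C. compact C \<and> C \<subseteq> U}. ennreal (h C))"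

definition outer_content :: "'a set \<Rightarrow> ennreal" where
  "outer_content A = (INF U\<in>{U. open U \<and> A \<subseteq> U}. inner_content U)"

lemma inner_content_upper: "compact C \<Longrightarrow> C \<subseteq> U \<Longrightarrow> ennreal (h C) \<le> inner_content U"
  unfolding inner_content_def by (rule SUP_upper) auto

lemma inner_content_mono: "U \<subseteq> V \<Longrightarrow> inner_content U \<le> inner_content V"
  unfolding inner_content_def by (intro SUP_subset_mono) auto

lemma outer_content_le: "open U \<Longrightarrow> A \<subseteq> U \<Longrightarrow> outer_content A \<le> inner_content U"
  unfolding outer_content_def by (rule INF_lower) auto

lemma outer_content_mono: "A \<subseteq> B \<Longrightarrow> outer_content A \<le> outer_content B"
  unfolding outer_content_def by (intro INF_superset_mono) auto

lemma outer_content_open: "open U \<Longrightarrow> outer_content U = inner_content U"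
  by (intro antisym outer_content_le) (auto simp: outer_content_def le_INF_iff inner_content_mono)

lemma outer_content_compact_ge: "compact C \<Longrightarrow> ennreal (h C) \<le> outer_content C"
  by (auto simp: outer_content_def le_INF_iff inner_content_upper)

text \<open>
  A compact set covered by two open sets is the union of two compact sets, one inside each: separate
  the two parts left over by disjoint open sets and remove these. Induction extends this to
  finitely many open sets.
\<close>

lemma content_le_sum_inner:
  assumes "finite I" "\<And>i. i \<in> I \<Longrightarrow> open (U i)" "compact C" "C \<subseteq> (\<Union>i\<in>I. U i)"
  shows "ennreal (h C) \<le> (\<Sum>i\<in>I. inner_content (U i))"
  using assms
proof (induction I arbitrary: C rule: finite_induct)
  case (insert j I)
  let ?V = "\<Union>i\<in>I. U i"
  have op: "open (U j)" "open ?V"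
    using insert.prems by auto
  have "compact (C - U j)" "compact (C - ?V)" "disjnt (C - U j) (C - ?V)"
    using insert.prems op by (auto simp: compact_diff disjnt_def)
  then obtain P Q where PQ: "open P" "open Q" "C - U j \<subseteq> P" "C - ?V \<subseteq> Q" "disjnt P Q"
    using Hausdorff_space_compact_separation[OF Hausdorff_space_euclidean_t2, of "C - U j" "C - ?V"]
    by (metis compactin_euclidean_iff open_openin)
  have cpt: "compact (C - P)" "compact (C - Q)"
    using insert.prems PQ by (auto simp: compact_diff)
  have "C = (C - P) \<union> (C - Q)"
    using PQ(5) by (auto simp: disjnt_def)
  then have "h C \<le> h (C - P) + h (C - Q)"
    using subadditive[OF cpt] by simp
  then have "ennreal (h C) \<le> ennreal (h (C - P)) + ennreal (h (C - Q))"
    by (simp add: nonneg ennreal_leI flip: ennreal_plus)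
  also have "\<dots> \<le> inner_content (U j) + (\<Sum>i\<in>I. inner_content (U i))"
    using PQ cpt insert.prems by (intro add_mono inner_content_upper insert.IH) auto
  finally show ?case
    using insert.hyps by simp
qed simp

lemma inner_content_UN_le:
  fixes U :: "nat \<Rightarrow> 'a set"
  assumes "\<And>i. open (U i)"
  shows "inner_content (\<Union>i. U i) \<le> (\<Sum>i. inner_content (U i))"
  unfolding inner_content_def[of "\<Union>i. U i"]
proof (rule SUP_least, clarify)
  fix C assume C: "compact C" "C \<subseteq> (\<Union>i. U i)"
  then obtain I where I: "finite I" "C \<subseteq> (\<Union>i\<in>I. U i)"
    using compactE_image[of C UNIV U] assms by metis
  then have "ennreal (h C) \<le> (\<Sum>i\<in>I. inner_content (U i))"
    using assms C by (intro content_le_sum_inner) auto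
  also have "\<dots> \<le> (\<Sum>i. inner_content (U i))"
    using I by (intro sum_le_suminf) auto
  finally show "ennreal (h C) \<le> (\<Sum>i. inner_content (U i))" .
qed

lemma outer_measure_space_outer_content: "outer_measure_space (Pow UNIV) outer_content"
  unfolding outer_measure_space_def
proof (intro conjI)
  have "outer_content {} = 0"
    by (simp add: outer_content_open inner_content_def)
  then show "positive (Pow UNIV) outer_content"
    by (simp add: positive_def)
  show "increasing (Pow UNIV) outer_content"
    by (simp add: increasing_def outer_content_mono)
  show "countably_subadditive (Pow UNIV) outer_content"
    unfolding countably_subadditive_def
  proof (intro allI impI)
    fix A :: "nat \<Rightarrow> 'a set"
    show "outer_content (\<Union>i. A i) \<le> (\<Sum>i. outer_content (A i))"
    proof (rule ennreal_le_epsilon)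
      fix e :: real
      assume "0 < e" and fin: "(\<Sum>i. outer_content (A i)) < top"
      \<comment> \<open>The errors \<open>e / 2\<^sup>n\<^sup>+\<^sup>1\<close> of the open approximations add up to \<open>e\<close>.\<close>
      have "\<exists>U. open U \<and> A n \<subseteq> U \<and> inner_content U \<le> outer_content (A n) + e * (1/2) ^ Suc n" for n
      proof -
        have "outer_content (A n) < top"
          using fin by (auto simp add: less_top dest!: ennreal_suminf_lessD)
        then have "outer_content (A n) < outer_content (A n) + e * (1/2) ^ Suc n"
          using \<open>0 < e\<close> by (auto simp: less_top)
        then show ?thesis
          unfolding outer_content_def INF_less_iff by (auto intro: less_imp_le)
      qed
      then obtain U where U: "\<And>n. open (U n)" "\<And>n. A n \<subseteq> U n"
        "\<And>n. inner_content (U n) \<le> outer_content (A n) + e * (1/2) ^ Suc n"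
        by metis
      have "outer_content (\<Union>i. A i) \<le> inner_content (\<Union>i. U i)"
        using U by (intro outer_content_le) auto
      also have "\<dots> \<le> (\<Sum>i. inner_content (U i))"
        using U by (intro inner_content_UN_le) auto
      also have "\<dots> \<le> (\<Sum>n. outer_content (A n) + e * (1/2) ^ Suc n)"
        using U by (intro suminf_le) auto
      also have "\<dots> = (\<Sum>n. outer_content (A n)) + (\<Sum>n. ennreal e * ennreal ((1/2) ^ Suc n))"
        using \<open>0 < e\<close> by (subst suminf_add[symmetric])
          (auto simp del: ennreal_suminf_cmult simp add: ennreal_mult[symmetric])
      also have "\<dots> = (\<Sum>n. outer_content (A n)) + e"
        unfolding ennreal_suminf_cmult
        by (subst suminf_ennreal_eq[OF zero_le_power power_half_series]) auto
      finally show "outer_content (\<Union>i. A i) \<le> (\<Sum>n. outer_content (A n)) + ennreal e" .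
    qed
  qed
qed

text \<open>
  The Caratheodory condition for the open set \<open>U\<close>, tested on an open set \<open>V\<close>. Exhaust \<open>V \<inter> U\<close> by compact
  sets \<open>C\<close> and then the open set \<open>V - C\<close>, which contains \<open>V - U\<close>, by compact sets \<open>D\<close>. The
  content is additive on the disjoint sets \<open>C\<close> and \<open>D\<close>.
\<close>

lemma inner_content_split:
  assumes "open U" "open V"
  shows "outer_content (V \<inter> U) + outer_content (V - U) \<le> inner_content V"
proof -
  have "ennreal (h C) + outer_content (V - U) \<le> inner_content V" if C: "compact C" "C \<subseteq> V \<inter> U" for C
  proof -
    have "open (V - C)"
      using \<open>open V\<close> C by (intro open_Diff compact_imp_closed)
    then have "outer_content (V - U) \<le> inner_content (V - C)"
      using C by (intro outer_content_le) auto
    also have "ennreal (h C) + inner_content (V - C) \<le> inner_content V"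
    proof -
      have "ennreal (h C) + ennreal (h D) \<le> inner_content V" if D: "compact D" "D \<subseteq> V - C" for D
      proof -
        have "h (C \<union> D) = h C + h D"
          using C D by (intro additive) auto
        then have "ennreal (h C) + ennreal (h D) = ennreal (h (C \<union> D))"
          by (simp add: nonneg)
        also have "\<dots> \<le> inner_content V"
          using C D by (intro inner_content_upper) auto
        finally show ?thesis .
      qed
      moreover have "{C'. compact C' \<and> C' \<subseteq> V - C} \<noteq> {}"
        by (auto intro: exI[of _ "{}"])
      ultimately show ?thesis
        unfolding inner_content_def[of "V - C"]
        by (subst ennreal_SUP_add_right) (auto intro: SUP_least)
    qed
    finally show ?thesis
      by (simp add: add_left_mono)
  qed
  moreover have "{C. compact C \<and> C \<subseteq> V \<inter> U} \<noteq> {}"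
    by (auto intro: exI[of _ "{}"])
  ultimately have "inner_content (V \<inter> U) + outer_content (V - U) \<le> inner_content V"
    unfolding inner_content_def[of "V \<inter> U"]
    by (subst ennreal_SUP_add_left[symmetric]) (auto intro: SUP_least)
  then show ?thesis
    using assms by (simp add: outer_content_open open_Int)
qed

lemma open_in_lambda_system:
  assumes "open U"
  shows "U \<in> lambda_system UNIV (Pow UNIV) outer_content"
  unfolding lambda_system_def
proof (clarsimp)
  fix A
  have "outer_content (U \<inter> A) + outer_content ((UNIV - U) \<inter> A) \<le> outer_content A"
    unfolding outer_content_def[of A]
  proof (rule INF_greatest, clarify)
    fix V assume V: "open V" "A \<subseteq> V"
    have "outer_content (U \<inter> A) + outer_content ((UNIV - U) \<inter> A) \<le> outer_content (V \<inter> U) + outer_content (V - U)"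
      using V by (intro add_mono outer_content_mono) auto
    also have "\<dots> \<le> inner_content V"
      using assms V by (intro inner_content_split)
    finally show "outer_content (U \<inter> A) + outer_content ((UNIV - U) \<inter> A) \<le> inner_content V" .
  qed
  moreover have "outer_content A \<le> outer_content (U \<inter> A) + outer_content ((UNIV - U) \<inter> A)"
  proof -
    interpret sigma_algebra UNIV "Pow (UNIV :: 'a set)"
      by (rule sigma_algebra_Pow)
    have "positive (Pow UNIV) outer_content" "countably_subadditive (Pow UNIV) outer_content"
      using outer_measure_space_outer_content by (auto simp: outer_measure_space_def)
    then have "subadditive (Pow UNIV) outer_content"
      by (rule countably_subadditive_subadditive)
    then have "outer_content ((U \<inter> A) \<union> ((UNIV - U) \<inter> A)) \<le> outer_content (U \<inter> A) + outer_content ((UNIV - U) \<inter> A)"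
      by (rule subadditiveD) auto
    moreover have "(U \<inter> A) \<union> ((UNIV - U) \<inter> A) = A" by auto
    ultimately show ?thesis by simp
  qed
  ultimately show "outer_content (U \<inter> A) + outer_content ((UNIV - U) \<inter> A) = outer_content A"
    by (rule antisym)
qed

definition content_measure :: "'a measure" where
  "content_measure = measure_of UNIV (sets borel) outer_content"

lemma sets_content_measure [simp]: "sets content_measure = sets borel"
  unfolding content_measure_def by (simp add: sets.sigma_sets_eq[of borel, simplified])

lemma space_content_measure [simp]: "space content_measure = UNIV"
  unfolding content_measure_def by simp

lemma emeasure_content_measure:
  assumes "A \<in> sets borel"
  shows "emeasure content_measure A = outer_content A"
proof -
  let ?L = "lambda_system UNIV (Pow UNIV) outer_content"
  have L: "measure_space UNIV ?L outer_content"
    using sigma_algebra.caratheodory_lemma[OF sigma_algebra_Pow outer_measure_space_outer_content] .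
  then have "sigma_algebra UNIV ?L"
    by (simp add: measure_space_def)
  then have "sets borel \<subseteq> ?L"
    unfolding sets_borel using open_in_lambda_system
    by (intro sigma_algebra.sigma_sets_subset) auto
  then have "measure_space UNIV (sets borel) outer_content"
    using measure_down[OF L] sets.sigma_algebra_axioms[of "borel :: 'a measure"] by simp
  then show ?thesis
    unfolding content_measure_def using assms
    by (intro emeasure_measure_of_sigma) (auto simp: measure_space_def)
qed

end

section \<open>Right Haar measure\<close>

lemma outer_content_right_translate:
  fixes h :: "'g::{topological_group_add,t2_space} set \<Rightarrow> real"
  assumes content: "compact_content h"
    and inv: "\<And>g C. compact C \<Longrightarrow> h (right_translate g C) = h C"
  shows "compact_content.outer_content h (right_translate g A) = compact_content.outer_content h A"
proof -
  interpret compact_content h by (rule content)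
  have inner: "inner_content U \<le> inner_content (right_translate g U)" for g U
    unfolding inner_content_def[of U]
  proof (rule SUP_least, clarify)
    fix C assume "compact C" "C \<subseteq> U"
    then show "ennreal (h C) \<le> inner_content (right_translate g U)"
      using inner_content_upper[of "right_translate g C" "right_translate g U"]
      by (simp add: inv compact_right_translate right_translate_mono)
  qed
  have outer: "outer_content (right_translate g A) \<le> outer_content A" for g A
    unfolding outer_content_def[of A]
  proof (rule INF_greatest, clarify)
    fix U assume "open U" "A \<subseteq> U"
    then have "outer_content (right_translate g A) \<le> inner_content (right_translate g U)"
      by (intro outer_content_le open_right_translate right_translate_mono)
    also have "\<dots> \<le> inner_content U"
      using inner[of "right_translate g U" "- g"] by simp
    finally show "outer_content (right_translate g A) \<le> inner_content U" .
  qed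
  show ?thesis
    using outer[of g A] outer[of "- g" "right_translate g A"] by simp
qed

lemma countably_many_translates_cover:
  fixes W :: "'g::{topological_group_add,second_countable_topology} set"
  assumes "open W" "0 \<in> W"
  obtains D where "countable D" "(\<Union>g\<in>D. right_translate g W) = UNIV"
proof -
  obtain \<F> where \<F>: "\<F> \<subseteq> range (\<lambda>g. right_translate g W)" "countable \<F>"
    "\<Union>\<F> = \<Union>(range (\<lambda>g. right_translate g W))"
    using Lindelof[of "range (\<lambda>g. right_translate g W)"] open_right_translate[OF \<open>open W\<close>] by auto
  obtain D where "countable D" "\<F> = (\<lambda>g. right_translate g W) ` D"
    using \<F>(1,2) by (metis countable_subset_image)
  moreover have "x \<in> \<Union>\<F>" for x
    using \<open>0 \<in> W\<close> by (auto simp: \<F>(3) mem_right_translate intro!: exI[of _ x])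
  ultimately show ?thesis
    using that[of D] by auto
qed

text \<open>
  The open set \<open>W\<close> has measure at most \<open>h K = 1\<close>, and countably many of its translates cover the group;
  hence the measure is \<open>\<sigma>\<close>-finite. It does not vanish since \<open>K\<close> has measure at least \<open>h K = 1\<close>.
\<close>

lemma exists_right_haar_measure:
  assumes "locally_compact_space
             (euclidean :: 'g::{topological_group_add,t2_space,second_countable_topology} topology)"
  obtains M :: "'g::{topological_group_add,t2_space,second_countable_topology} measure"
  where "sets M = sets borel" "sigma_finite_measure M" "emeasure M UNIV \<noteq> 0"
    "\<And>g A. A \<in> sets borel \<Longrightarrow> emeasure M (right_translate g A) = emeasure M A"
proof -
  obtain h :: "'g set \<Rightarrow> real" and K W where h: "compact_content h"
    and inv: "\<And>g C. compact C \<Longrightarrow> h (right_translate g C) = h C"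
    and KW: "compact K" "open W" "0 \<in> W" "W \<subseteq> K" "h K = 1"
    using exists_haar_content[OF assms] by metis
  interpret compact_content h by (rule h)
  have meas: "right_translate g A \<in> sets borel" if "A \<in> sets borel" for g and A :: "'g set"
  proof -
    have "(\<lambda>x. x - g) \<in> borel_measurable borel"
      by (intro borel_measurable_continuous_onI continuous_intros)
    then show ?thesis
      using that measurable_sets[of "\<lambda>x. x - g" borel borel A] by (simp add: right_translate_eq_vimage)
  qed
  have trans: "emeasure content_measure (right_translate g A) = emeasure content_measure A"
    if "A \<in> sets borel" for g A
    using that meas by (simp add: emeasure_content_measure outer_content_right_translate[OF h inv])
  have "inner_content W \<le> 1"
    unfolding inner_content_def
  proof (rule SUP_least, clarify)
    fix C assume "compact C" "C \<subseteq> W"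
    then have "h C \<le> h K"
      using KW by (intro mono) auto
    then show "ennreal (h C) \<le> 1" by (simp add: KW(5))
  qed
  then have "emeasure content_measure W \<le> 1"
    using KW by (simp add: emeasure_content_measure outer_content_open)
  then have fin: "emeasure content_measure (right_translate g W) \<noteq> \<infinity>" for g
    using KW by (subst trans) (auto simp: top_unique)
  have "sigma_finite_measure content_measure"
  proof
    obtain D where D: "countable D" "(\<Union>g\<in>D. right_translate g W) = UNIV"
      using countably_many_translates_cover KW by metis
    show "\<exists>A. countable A \<and> A \<subseteq> sets content_measure \<and> \<Union>A = space content_measure \<and>
        (\<forall>a\<in>A. emeasure content_measure a \<noteq> \<infinity>)"
      using D fin KW meas
      by (intro exI[of _ "(\<lambda>g. right_translate g W) ` D"]) auto
  qed
  moreover have "emeasure content_measure UNIV \<noteq> 0"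
  proof -
    have "1 \<le> outer_content UNIV"
      using outer_content_compact_ge[OF KW(1)] outer_content_mono[of K UNIV] KW(5) by simp
    then show ?thesis
      by (auto simp: emeasure_content_measure)
  qed
  ultimately show ?thesis
    using that[of content_measure] trans by simp
qed

section \<open>Absolute continuity and convergence to zero\<close>

text \<open>
  If the \<open>N\<close>-measures stayed above \<open>e\<close> along a subsequence, then a further subsequence would have
  summable \<open>M\<close>-measures. Its limes superior would be \<open>M\<close>-null by Borel-Cantelli, but of
  \<open>N\<close>-measure at least \<open>e\<close> by continuity from above.
\<close>

lemma tendsto_measure_zero_if_absolutely_continuous:
  assumes "finite_measure M" "finite_measure N"
    and sets: "sets N = sets M"
    and ac: "absolutely_continuous M N"
    and D: "\<And>n. D n \<in> sets M"
    and lim: "(\<lambda>n::nat. measure M (D n)) \<longlonglongrightarrow> 0"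
  shows "(\<lambda>n. measure N (D n)) \<longlonglongrightarrow> 0"
proof (rule ccontr)
  interpret M: finite_measure M by fact
  interpret N: finite_measure N by fact
  assume "\<not> ?thesis"
  then obtain e where "e > 0" and e: "\<And>k. \<exists>n\<ge>k. measure N (D n) \<ge> e"
    unfolding LIMSEQ_iff by (auto simp: not_less)
  have "\<exists>n. measure N (D n) \<ge> e \<and> measure M (D n) < (1/2) ^ k" for k
  proof -
    have "\<forall>\<^sub>F n in sequentially. measure M (D n) < (1/2) ^ k"
      by (intro order_tendstoD(2)[OF lim]) auto
    then show ?thesis
      using e unfolding eventually_sequentially by (metis)
  qed
  then obtain r where r: "\<And>k. measure N (D (r k)) \<ge> e" "\<And>k. measure M (D (r k)) < (1/2) ^ k"
    by metis
  have [measurable]: "D n \<in> sets N" for n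
    using D sets by simp
  define U where "U n = (\<Union>k\<in>{n..}. D (r k))" for n
  have limsup: "limsup (\<lambda>k. D (r k)) = (\<Inter>n. U n)"
    by (simp add: limsup_INF_SUP U_def)
  have "summable (\<lambda>k. measure M (D (r k)))"
    by (rule summable_comparison_test'[of "\<lambda>k. (1/2) ^ k" 0])
      (use r(2) in \<open>auto simp: summable_geometric intro: less_imp_le\<close>)
  then have "limsup (\<lambda>k. D (r k)) \<in> null_sets M"
    using D by (intro borel_cantelli_limsup1) (auto simp: M.emeasure_eq_measure)
  then have "(\<Inter>n. U n) \<in> null_sets N"
    using ac limsup by (auto simp: absolutely_continuous_def)
  then have "measure N (\<Inter>n. U n) = 0"
    by (simp add: measure_eq_0_null_sets)
  moreover have "e \<le> measure N (\<Inter>n. U n)"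
  proof (rule LIMSEQ_le_const)
    show "(\<lambda>n. measure N (U n)) \<longlonglongrightarrow> measure N (\<Inter>n. U n)"
    proof (rule N.finite_Lim_measure_decseq)
      show "range U \<subseteq> sets N"
        by (auto simp: U_def)
      show "decseq U"
        unfolding decseq_def U_def by (intro allI impI UN_mono) auto
    qed
    have "e \<le> measure N (U n)" for n
      using r(1)[of n] N.finite_measure_mono[of "D (r n)" "U n"] by (force simp: U_def)
    then show "\<exists>N'. \<forall>n\<ge>N'. e \<le> measure N (U n)" by auto
  qed
  ultimately show False using \<open>e > 0\<close> by simp
qed

section \<open>Strong ergodicity from a quasi-invariant measure on the group\<close>

text \<open>
  Right translations are asked to preserve only the null sets of the measure \<open>\<nu>\<close> on the group. This
  leaves room for a finite \<open>\<nu>\<close>, for which constants can serve as dominating functions, even when Haar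
  measure is infinite.
\<close>

locale transitive_pmp_action = prob_space m
  for \<alpha> :: "'g::{group_add,topological_space} \<Rightarrow> 'x \<Rightarrow> 'x" and m :: "'x measure" +
  fixes \<nu> :: "'g measure"
  assumes acts: "acts_on \<alpha> (space m)"
    and transitive: "transitive_on \<alpha> (space m)"
    and joint_measurable: "(\<lambda>(x, g). \<alpha> g x) \<in> m \<Otimes>\<^sub>M \<nu> \<rightarrow>\<^sub>M m"
    and invariant: "\<And>g. distr m m (\<alpha> g) = m"
    and finite_nu: "finite_measure \<nu>"
    and space_nu: "space \<nu> = UNIV"
    and nu_nonzero: "emeasure \<nu> UNIV \<noteq> 0"
    and quasi_invariant: "\<And>g E. E \<in> null_sets \<nu> \<Longrightarrow> (\<lambda>x. x + g) -` E \<in> null_sets \<nu>"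
begin

sublocale nu: finite_measure \<nu>
  by (rule finite_nu)

sublocale P: pair_sigma_finite m \<nu> ..

sublocale PP: pair_sigma_finite m m ..

lemma translation_measurable [measurable]: "\<alpha> g \<in> m \<rightarrow>\<^sub>M m"
  using measurable_compose[OF measurable_Pair[OF measurable_ident measurable_const] joint_measurable, of g]
  by (simp add: space_nu)

lemma in_space [simp]: "x \<in> space m \<Longrightarrow> \<alpha> g x \<in> space m"
  using acts by (auto simp: acts_on_def)

lemma inverse_action [simp]: "x \<in> space m \<Longrightarrow> \<alpha> (- g) (\<alpha> g x) = x" "x \<in> space m \<Longrightarrow> \<alpha> g (\<alpha> (- g) x) = x"
  using acts unfolding acts_on_def by (metis left_minus right_minus)+

lemma image_eq_vimage:
  assumes "B \<subseteq> space m"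
  shows "\<alpha> g ` B = \<alpha> (- g) -` B \<inter> space m"
  using assms by (force simp: subset_eq image_iff)

lemma orbit_map_measurable [measurable]: "x \<in> space m \<Longrightarrow> (\<lambda>g. \<alpha> g x) \<in> \<nu> \<rightarrow>\<^sub>M m"
  using measurable_compose[OF measurable_Pair[OF measurable_const measurable_ident] joint_measurable, of x]
  by simp

text \<open>
  The joint law of a random point and of its image under an independent random group element.
\<close>

definition orbit_coupling :: "('x \<times> 'x) measure" where
  "orbit_coupling = distr (m \<Otimes>\<^sub>M \<nu>) (m \<Otimes>\<^sub>M m) (\<lambda>(x, g). (x, \<alpha> g x))"

lemma coupling_measurable [measurable]: "(\<lambda>(x, g). (x, \<alpha> g x)) \<in> m \<Otimes>\<^sub>M \<nu> \<rightarrow>\<^sub>M m \<Otimes>\<^sub>M m"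
  unfolding case_prod_beta
  by (intro measurable_Pair measurable_fst joint_measurable[unfolded case_prod_beta])

text \<open>
  Every point of the space has the form \<open>k x\<close>, and \<open>g (k x) = (g + k) x\<close>, so right quasi-invariance
  spreads the hypothesis from \<open>x\<close> to all points. Fubini then produces one \<open>g\<close> under which almost every
  point lands outside \<open>E\<close>, and \<open>m\<close> is invariant under that \<open>g\<close>.
\<close>

lemma null_if_orbit_null:
  assumes E: "E \<in> sets m" and x: "x \<in> space m" and null: "AE g in \<nu>. \<alpha> g x \<notin> E"
  shows "E \<in> null_sets m"
proof -
  have "AE g in \<nu>. \<alpha> g y \<notin> E" if y: "y \<in> space m" for y
  proof -
    obtain k where k: "\<alpha> k x = y"
      using transitive x y by (auto simp: transitive_on_def)
    have "{g. \<alpha> g x \<in> E} \<in> sets \<nu>"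
      using measurable_sets[OF orbit_map_measurable[OF x] E] by (simp add: vimage_def space_nu)
    then have "{g. \<alpha> g x \<in> E} \<in> null_sets \<nu>"
      using null by (subst AE_iff_null_sets) (auto simp: space_nu)
    then have "(\<lambda>g. g + k) -` {g. \<alpha> g x \<in> E} \<in> null_sets \<nu>"
      by (rule quasi_invariant)
    moreover have "\<alpha> (g + k) x = \<alpha> g y" for g
      using acts x k by (auto simp: acts_on_def)
    ultimately have "{g. \<alpha> g y \<in> E} \<in> null_sets \<nu>"
      by simp
    then show ?thesis
      by (auto dest: AE_not_in)
  qed
  then have "AE y in m. AE g in \<nu>. \<alpha> g y \<notin> E"
    by (rule AE_I2)
  moreover have "{p \<in> space (m \<Otimes>\<^sub>M \<nu>). \<alpha> (snd p) (fst p) \<notin> E} \<in> sets (m \<Otimes>\<^sub>M \<nu>)"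
    using measurable_sets[OF joint_measurable, of "space m - E"] E
    by (simp add: vimage_def Int_def case_prod_beta space_pair_measure mem_Times_iff conj_commute cong: conj_cong)
  ultimately have ae: "AE g in \<nu>. AE y in m. \<alpha> g y \<notin> E"
    using P.AE_commute[of "\<lambda>y g. \<alpha> g y \<notin> E"] by simp
  have "\<not> (AE g in \<nu>. False)"
  proof
    assume "AE g in \<nu>. False"
    moreover have "UNIV \<in> sets \<nu>"
      using sets.top[of \<nu>] by (simp add: space_nu)
    ultimately have "UNIV \<in> null_sets \<nu>"
      by (simp add: AE_iff_null_sets)
    then show False
      using nu_nonzero by (simp add: null_sets_def)
  qed
  then obtain g where g: "AE y in m. \<alpha> g y \<notin> E"
    using eventually_mono[OF ae, of "\<lambda>_. False"] by blast
  then have "AE y in distr m m (\<alpha> g). y \<notin> E"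
    using E by (subst AE_distr_iff) auto
  then show ?thesis
    using E unfolding invariant by (simp add: AE_iff_null_sets)
qed

text \<open>
  Apply the preceding lemma to almost every vertical section of a null set of the coupling.
\<close>

lemma product_absolutely_continuous: "absolutely_continuous orbit_coupling (m \<Otimes>\<^sub>M m)"
  unfolding absolutely_continuous_def
proof
  fix E assume E: "E \<in> null_sets orbit_coupling"
  then have [measurable]: "E \<in> sets (m \<Otimes>\<^sub>M m)"
    by (auto simp: orbit_coupling_def)
  have "AE p in orbit_coupling. p \<notin> E"
    using E by (rule AE_not_in)
  then have "AE p in m \<Otimes>\<^sub>M \<nu>. (\<lambda>(x, g). (x, \<alpha> g x)) p \<notin> E"
    unfolding orbit_coupling_def by (subst (asm) AE_distr_iff) auto
  then have "AE x in m. AE g in \<nu>. (x, \<alpha> g x) \<notin> E"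
    by (rule P.AE_pair[of "\<lambda>p. (\<lambda>(x, g). (x, \<alpha> g x)) p \<notin> E", simplified])
  then have "AE x in m. AE y in m. (x, y) \<notin> E"
    using AE_space
  proof eventually_elim
    fix x assume "AE g in \<nu>. (x, \<alpha> g x) \<notin> E" and x: "x \<in> space m"
    then have "Pair x -` E \<in> null_sets m"
      by (intro null_if_orbit_null[OF _ x]) auto
    then show "AE y in m. (x, y) \<notin> E"
      by (auto dest: AE_not_in)
  qed
  then have "AE p in m \<Otimes>\<^sub>M m. p \<notin> E"
    by (intro PP.AE_pair_measure) auto
  then show "E \<in> null_sets (m \<Otimes>\<^sub>M m)"
    by (simp add: AE_iff_null_sets)
qed

text \<open>
  For fixed \<open>g\<close>, a point \<open>x\<close> of \<open>B n\<close> with \<open>g x\<close> outside \<open>B n\<close> lies in the symmetric difference of \<open>B n\<close>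
  and its translate by \<open>- g\<close>. Integrate over \<open>g\<close> and use dominated convergence.
\<close>

lemma coupling_rectangle_tendsto_0:
  assumes B: "\<And>n::nat. B n \<in> sets m"
    and almost_invariant: "\<And>g. (\<lambda>n. measure m (sym_diff (B n) (\<alpha> g ` B n))) \<longlonglongrightarrow> 0"
  shows "(\<lambda>n. measure orbit_coupling (B n \<times> (space m - B n))) \<longlonglongrightarrow> 0"
proof -
  define S where "S n = (\<lambda>(x, g). (x, \<alpha> g x)) -` (B n \<times> (space m - B n)) \<inter> space (m \<Otimes>\<^sub>M \<nu>)" for n
  define f where "f n g = measure m ((\<lambda>x. (x, g)) -` S n)" for n g
  have sub: "B n \<subseteq> space m" for n
    using B sets.sets_into_space by auto
  have meas: "S n \<in> sets (m \<Otimes>\<^sub>M \<nu>)" for n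
    unfolding S_def using B by (intro measurable_sets[OF coupling_measurable]) auto
  have f_measurable: "f n \<in> borel_measurable \<nu>" for n
    unfolding f_def[abs_def] measure_def
    by (intro measurable_compose[OF P.measurable_emeasure_Pair2[OF meas]] borel_measurable_enn2real) simp
  have "(\<lambda>n. \<integral>g. f n g \<partial>\<nu>) \<longlonglongrightarrow> (\<integral>g. 0 \<partial>\<nu>)"
  proof (rule integral_dominated_convergence[where w = "\<lambda>_. 1"])
    show "AE g in \<nu>. (\<lambda>n. f n g) \<longlonglongrightarrow> 0"
    proof (rule AE_I2, rule tendsto_sandwich[OF _ _ tendsto_const almost_invariant])
      fix g
      have "(\<lambda>x. (x, g)) -` S n \<subseteq> sym_diff (B n) (\<alpha> (- g) ` B n)" for n
        using sub by (auto simp: S_def image_eq_vimage space_pair_measure)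
      moreover have "sym_diff (B n) (\<alpha> (- g) ` B n) \<in> sets m" for n
        using B sub by (simp add: image_eq_vimage)
      ultimately show "\<forall>\<^sub>F n in sequentially. f n g \<le> measure m (sym_diff (B n) (\<alpha> (- g) ` B n))"
        unfolding f_def by (intro always_eventually allI finite_measure_mono)
    qed (simp add: f_def)
    show "f n \<in> borel_measurable \<nu>" for n by (rule f_measurable)
  qed (auto simp: f_def)
  moreover have "measure orbit_coupling (B n \<times> (space m - B n)) = (\<integral>g. f n g \<partial>\<nu>)" for n
  proof -
    have "emeasure orbit_coupling (B n \<times> (space m - B n)) = (\<integral>\<^sup>+g. ennreal (f n g) \<partial>\<nu>)"
      unfolding orbit_coupling_def f_def using B meas
      by (subst emeasure_distr) (auto simp: P.emeasure_pair_measure_alt2 emeasure_eq_measure simp flip: S_def)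
    moreover have "(\<integral>g. f n g \<partial>\<nu>) = enn2real (\<integral>\<^sup>+g. ennreal (f n g) \<partial>\<nu>)"
      by (rule integral_eq_nn_integral[OF f_measurable]) (simp add: f_def)
    ultimately show ?thesis
      by (simp add: measure_def)
  qed
  ultimately show ?thesis
    by simp
qed

lemma strongly_ergodic: "strongly_ergodic \<alpha> m"
  unfolding strongly_ergodic_def
proof (intro allI impI)
  fix B :: "nat \<Rightarrow> 'x set"
  assume B: "\<forall>n. B n \<in> sets m"
    and almost_invariant: "\<forall>g. (\<lambda>n. measure m (sym_diff (B n) (\<alpha> g ` B n))) \<longlonglongrightarrow> 0"
  have "finite_measure orbit_coupling"
    unfolding orbit_coupling_def
    by (intro finite_measure.finite_measure_distr coupling_measurable finite_measure_pair_measure)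
      (rule finite_measure_axioms nu.finite_measure_axioms)+
  moreover have "finite_measure (m \<Otimes>\<^sub>M m)"
    by (intro finite_measure_pair_measure finite_measure_axioms)
  ultimately have "(\<lambda>n. measure (m \<Otimes>\<^sub>M m) (B n \<times> (space m - B n))) \<longlonglongrightarrow> 0"
    using B almost_invariant
    by (intro tendsto_measure_zero_if_absolutely_continuous[OF _ _ _ product_absolutely_continuous]
        coupling_rectangle_tendsto_0) (auto simp: orbit_coupling_def)
  moreover have "measure (m \<Otimes>\<^sub>M m) (B n \<times> (space m - B n)) = measure m (B n) * (1 - measure m (B n))" for n
  proof -
    have "emeasure (m \<Otimes>\<^sub>M m) (B n \<times> (space m - B n)) = emeasure m (B n) * emeasure m (space m - B n)"
      using B by (intro emeasure_pair_measure_Times) auto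
    then show ?thesis
      using B by (simp add: measure_def enn2real_mult prob_compl[unfolded measure_def])
  qed
  ultimately show "(\<lambda>n. measure m (B n) * (1 - measure m (B n))) \<longlonglongrightarrow> 0"
    by simp
qed

end

section \<open>Joint measurability of continuous transitive actions\<close>

lemma space_borel_of [simp]: "space (borel_of X) = topspace X"
  and sets_borel_of: "sets (borel_of X) = sigma_sets (topspace X) {U. openin X U}"
  unfolding borel_of_def
  by (auto simp: space_measure_of_conv intro!: sets_measure_of dest: openin_subset)

lemma openin_borel_of: "openin X U \<Longrightarrow> U \<in> sets (borel_of X)"
  by (simp add: sets_borel_of)

text \<open>
  The Borel sets of a product need not be generated by measurable rectangles when one factor fails to be
  second countable. Here \<open>X\<close> is a continuous image of a second countable space \<open>'a\<close>; pulling the rectangles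
  inside \<open>W\<close> back to \<open>'a \<times> 'b\<close> and using that this space is hereditarily Lindelof shows that
  countably many rectangles suffice.
\<close>

lemma openin_prod_in_sets_pair_measure:
  fixes f :: "'a::second_countable_topology \<Rightarrow> 'x" and W :: "('x \<times> 'b::second_countable_topology) set"
  assumes f: "continuous_map euclidean X f" "f ` UNIV = topspace X"
    and W: "openin (prod_topology X euclidean) W"
  shows "W \<in> sets (borel_of X \<Otimes>\<^sub>M borel)"
proof -
  define R where "R = {A \<times> B | A B. openin X A \<and> open B \<and> A \<times> B \<subseteq> W}"
  have W_eq: "W = \<Union>R"
  proof
    show "W \<subseteq> \<Union>R"
    proof
      fix p assume "p \<in> W"
      then obtain A B where "openin X A" "open B" "p \<in> A \<times> B" "A \<times> B \<subseteq> W"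
        using W unfolding openin_prod_topology_alt by (metis mem_Sigma_iff open_openin prod.collapse)
      then show "p \<in> \<Union>R"
        unfolding R_def by blast
    qed
  qed (auto simp: R_def)
  let ?f = "\<lambda>(a, b). (f a, b)"
  have "open (?f -` S)" if "S \<in> R" for S
  proof -
    from that obtain A B where S: "S = A \<times> B" "openin X A" "open B"
      by (auto simp: R_def)
    have "open (f -` A)"
      using openin_continuous_map_preimage[OF f(1) S(2)] by (simp add: vimage_def)
    moreover have "?f -` S = (f -` A) \<times> B"
      by (auto simp: S)
    ultimately show ?thesis
      using S(3) by (simp add: open_Times)
  qed
  then have "open T" if "T \<in> (\<lambda>S. ?f -` S) ` R" for T
    using that by auto
  then obtain \<F> where \<F>: "\<F> \<subseteq> (\<lambda>S. ?f -` S) ` R" "countable \<F>" "\<Union>\<F> = \<Union>((\<lambda>S. ?f -` S) ` R)"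
    by (rule Lindelof)
  obtain R' where R': "countable R'" "R' \<subseteq> R" "\<F> = (\<lambda>S. ?f -` S) ` R'"
    using \<F>(1,2) by (metis countable_subset_image)
  have "W \<subseteq> \<Union>R'"
  proof
    fix p assume p: "p \<in> W"
    have "W \<subseteq> topspace X \<times> UNIV"
      using openin_subset[OF W] by simp
    then have "fst p \<in> f ` UNIV"
      using p f(2) by auto
    then obtain a where a: "p = ?f (a, snd p)"
      by (auto simp: prod_eq_iff)
    then have "(a, snd p) \<in> \<Union>\<F>"
      using p unfolding \<F>(3) W_eq by auto
    then show "p \<in> \<Union>R'"
      using a R'(3) by auto
  qed
  then have "W = \<Union>R'"
    using R'(2) W_eq by blast
  moreover have "S \<in> sets (borel_of X \<Otimes>\<^sub>M borel)" if "S \<in> R'" for S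
    using that R'(2) by (auto simp: R_def intro!: pair_measureI openin_borel_of)
  ultimately show ?thesis
    using R'(1) by (auto intro: sets.countable_Union)
qed

text \<open>
  The orbit map of any point exhibits the space as a continuous image of the group.
\<close>

lemma continuous_action_joint_measurable:
  fixes X :: "'x topology" and \<alpha> :: "'g::{topological_group_add,second_countable_topology} \<Rightarrow> 'x \<Rightarrow> 'x"
  assumes action: "continuous_action \<alpha> X" and trans: "transitive_on \<alpha> (topspace X)"
    and nonempty: "topspace X \<noteq> {}"
    and m: "sets m = sets (borel_of X)" and \<nu>: "sets \<nu> = sets borel"
  shows "(\<lambda>(x, g). \<alpha> g x) \<in> m \<Otimes>\<^sub>M \<nu> \<rightarrow>\<^sub>M m"
proof -
  have cont: "continuous_map (prod_topology euclidean X) X (\<lambda>(g, x). \<alpha> g x)"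
    and acts: "acts_on \<alpha> (topspace X)"
    using action by (auto simp: continuous_action_def)
  obtain x0 where x0: "x0 \<in> topspace X"
    using nonempty by blast
  have orbit: "continuous_map euclidean X (\<lambda>g. \<alpha> g x0)"
  proof -
    have "continuous_map euclidean (prod_topology euclidean X) (\<lambda>g. (g, x0))"
      using x0 by (simp add: continuous_map_pairedI)
    from continuous_map_compose[OF this cont] show ?thesis
      by (simp add: o_def)
  qed
  have onto: "(\<lambda>g. \<alpha> g x0) ` UNIV = topspace X"
    using x0 acts trans by (auto simp: acts_on_def transitive_on_def image_iff) metis
  have swap: "continuous_map (prod_topology X euclidean) X (\<lambda>(x, g). \<alpha> g x)"
  proof -
    have "continuous_map (prod_topology X euclidean) (prod_topology (euclidean :: 'g topology) X) (\<lambda>p. (snd p, fst p))"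
      by (intro continuous_map_pairedI continuous_map_fst continuous_map_snd)
    from continuous_map_compose[OF this cont] show ?thesis
      by (simp add: o_def case_prod_unfold)
  qed
  have "(\<lambda>(x, g). \<alpha> g x) \<in> borel_of X \<Otimes>\<^sub>M borel \<rightarrow>\<^sub>M borel_of X"
  proof (rule measurable_sigma_sets[OF sets_borel_of])
    show "{U. openin X U} \<subseteq> Pow (topspace X)"
      by (auto dest: openin_subset)
    show "(\<lambda>(x, g). \<alpha> g x) \<in> space (borel_of X \<Otimes>\<^sub>M (borel :: 'g measure)) \<rightarrow> topspace X"
      using acts by (auto simp: space_pair_measure acts_on_def)
    fix U assume "U \<in> {U. openin X U}"
    then have "openin (prod_topology X euclidean)
        {p \<in> topspace (prod_topology X (euclidean :: 'g topology)). (\<lambda>(x, g). \<alpha> g x) p \<in> U}"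
      using openin_continuous_map_preimage[OF swap] by simp
    from openin_prod_in_sets_pair_measure[OF orbit onto this]
    show "(\<lambda>(x, g). \<alpha> g x) -` U \<inter> space (borel_of X \<Otimes>\<^sub>M (borel :: 'g measure))
        \<in> sets (borel_of X \<Otimes>\<^sub>M borel)"
      by (simp add: space_pair_measure vimage_def Int_def conj_commute)
  qed
  then show ?thesis
    using m \<nu> by (simp cong: measurable_cong_sets sets_pair_measure_cong)
qed

section \<open>Transitive actions and coset spaces\<close>

text \<open>
  Multiplying the \<open>\<sigma>\<close>-finite Haar measure by a strictly positive integrable density makes it finite
  without changing its null sets.
\<close>

lemma strongly_ergodic_transitive_action:
  fixes X :: "'x topology"
    and \<alpha> :: "'g::{topological_group_add,t2_space,second_countable_topology} \<Rightarrow> 'x \<Rightarrow> 'x"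
  assumes lc: "locally_compact_space (euclidean :: 'g topology)"
    and action: "continuous_action \<alpha> X" and trans: "transitive_on \<alpha> (topspace X)"
    and m: "invariant_borel_prob \<alpha> X m"
  shows "strongly_ergodic \<alpha> m"
proof -
  obtain \<mu> :: "'g measure" where \<mu>: "sets \<mu> = sets borel" "sigma_finite_measure \<mu>" "emeasure \<mu> UNIV \<noteq> 0"
    and inv: "\<And>g A. A \<in> sets borel \<Longrightarrow> emeasure \<mu> (right_translate g A) = emeasure \<mu> A"
    using exists_right_haar_measure[OF lc] by metis
  have [simp]: "space \<mu> = UNIV"
    using sets_eq_imp_space_eq[OF \<mu>(1)] by simp
  obtain f where f: "f \<in> borel_measurable \<mu>" "integral\<^sup>N \<mu> f \<noteq> \<infinity>" "\<And>x. 0 < f x"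
    using sigma_finite_measure.Ex_finite_integrable_function[OF \<mu>(2)] by auto
  define \<nu> where "\<nu> = density \<mu> f"
  have null: "E \<in> null_sets \<nu> \<longleftrightarrow> E \<in> null_sets \<mu>" for E
  proof -
    have "(AE x in \<mu>. x \<in> E \<longrightarrow> f x = 0) \<longleftrightarrow> (AE x in \<mu>. x \<notin> E)"
      using f(3) by (intro AE_cong) (metis less_irrefl)
    then show ?thesis
      unfolding \<nu>_def null_sets_density_iff[OF f(1)]
      by (auto simp: AE_iff_null_sets[symmetric] null_setsD2)
  qed
  have m': "prob_space m" "sets m = sets (borel_of X)" "\<And>g. distr m m (\<alpha> g) = m"
    using m by (auto simp: invariant_borel_prob_def)
  have space_m: "space m = topspace X"
    using sets_eq_imp_space_eq[OF m'(2)] by simp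
  interpret transitive_pmp_action \<alpha> m \<nu>
  proof (intro transitive_pmp_action.intro transitive_pmp_action_axioms.intro)
    show "prob_space m" by fact
    show "acts_on \<alpha> (space m)" "transitive_on \<alpha> (space m)"
      using action trans by (auto simp: space_m continuous_action_def)
    have "topspace X \<noteq> {}"
      using prob_space.not_empty[OF m'(1)] space_m by simp
    then show "(\<lambda>(x, g). \<alpha> g x) \<in> m \<Otimes>\<^sub>M \<nu> \<rightarrow>\<^sub>M m"
      using action trans m'(2) \<mu>(1) by (intro continuous_action_joint_measurable) (auto simp: \<nu>_def)
    show "distr m m (\<alpha> g) = m" for g by fact
    show "finite_measure \<nu>"
      using f(2) emeasure_density[OF f(1), of UNIV] \<mu>(1) by (intro finite_measureI) (simp add: \<nu>_def)
    show "space \<nu> = UNIV" by (simp add: \<nu>_def)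
    show "emeasure \<nu> UNIV \<noteq> 0"
      using null[of UNIV] \<mu>(1,3) by (auto simp: null_sets_def \<nu>_def)
    show "(\<lambda>x. x + g) -` E \<in> null_sets \<nu>" if "E \<in> null_sets \<nu>" for g E
    proof -
      have "E \<in> null_sets \<mu>" using that null by simp
      then have E: "E \<in> sets borel" "emeasure \<mu> E = 0"
        using \<mu>(1) by (auto simp: null_sets_def)
      have eq: "(\<lambda>x. x + g) -` E = right_translate (- g) E"
        by (auto simp: right_translate_eq_vimage)
      have "(\<lambda>x. x + g) \<in> borel_measurable borel"
        by (intro borel_measurable_continuous_onI continuous_intros)
      then have "(\<lambda>x. x + g) -` E \<in> sets borel"
        using measurable_sets[of "\<lambda>x. x + g" borel borel E] E by simp
      then show ?thesis
        using E inv[OF E(1), of "- g"] \<mu>(1) unfolding null eq by (simp add: null_sets_def)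
    qed
  qed
  show ?thesis by (rule strongly_ergodic)
qed

text \<open>
  The product of a quotient map with a locally compact Hausdorff factor is again a quotient map, so
  continuity may be checked upstairs, where the action is \<open>(g, x) \<mapsto> (g + x) + H\<close>.
\<close>

lemma continuous_action_translate:
  fixes H :: "'g::{topological_group_add,t2_space} set"
  assumes lc: "locally_compact_space (euclidean :: 'g topology)"
  shows "continuous_action translate (coset_space H)"
proof -
  have "quotient_map (prod_topology euclidean euclidean) (prod_topology euclidean (coset_space H))
      (\<lambda>(g::'g, x). (g, left_coset H x))"
    using quotient_map_prod_right[OF lc _ quotient_map_coset_space[of H]] Hausdorff_space_euclidean_t2
    by blast
  moreover have "continuous_map (prod_topology euclidean euclidean) (coset_space H)
      ((\<lambda>(g, C). translate g C) \<circ> (\<lambda>(g::'g, x). (g, left_coset H x)))"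
  proof -
    have "continuous_map (prod_topology euclidean euclidean) euclidean (\<lambda>p::'g \<times> 'g. fst p + snd p)"
      by (simp add: continuous_intros)
    from continuous_map_compose[OF this quotient_imp_continuous_map[OF quotient_map_coset_space[of H]]]
    have "continuous_map (prod_topology euclidean euclidean) (coset_space H)
        (\<lambda>p. left_coset H (fst p + snd p))"
      by (simp add: o_def)
    moreover have "(\<lambda>(g, C). translate g C) \<circ> (\<lambda>(g::'g, x). (g, left_coset H x))
        = (\<lambda>p. left_coset H (fst p + snd p))"
      by (auto simp: fun_eq_iff translate_def left_coset_def image_image add.assoc)
    ultimately show ?thesis by simp
  qed
  ultimately have "continuous_map (prod_topology euclidean (coset_space H)) (coset_space H)
      (\<lambda>(g, C). translate g C)"
    by (rule continuous_compose_quotient_map)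
  then show ?thesis
    by (simp add: continuous_action_def topspace_coset_space acts_on_translate)
qed

lemma transitive_on_translate: "transitive_on translate (topspace (coset_space H))"
proof -
  have "translate (b - a) (left_coset H a) = left_coset H b" for a b
    by (simp add: translate_def left_coset_def image_image add.assoc[symmetric])
  then show ?thesis
    unfolding transitive_on_def topspace_coset_space by blast
qed

theorem proposition1p9:
  assumes "locally_compact_space
             (euclidean :: 'g::{topological_group_add,t2_space,second_countable_topology} topology)"
  shows "(\<forall>(H :: 'g set) m.
            add_subgroup H \<and> closed H \<and> finite_covolume H \<and>
            invariant_borel_prob translate (coset_space H) m \<longrightarrow>
            strongly_ergodic translate m) \<and>
         (\<forall>(X :: 'x topology) (\<alpha> :: 'g \<Rightarrow> 'x \<Rightarrow> 'x) m.
            Hausdorff_space X \<and> continuous_action \<alpha> X \<and> transitive_on \<alpha> (topspace X) \<and>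
            invariant_borel_prob \<alpha> X m \<longrightarrow>
            strongly_ergodic \<alpha> m)"
proof (intro conjI allI impI; elim conjE)
  fix H :: "'g set" and m
  assume "invariant_borel_prob translate (coset_space H) m"
  then show "strongly_ergodic translate m"
    by (rule strongly_ergodic_transitive_action[OF assms continuous_action_translate[OF assms] transitive_on_translate])
next
  fix X :: "'x topology" and \<alpha> :: "'g \<Rightarrow> 'x \<Rightarrow> 'x" and m
  assume "continuous_action \<alpha> X" "transitive_on \<alpha> (topspace X)" "invariant_borel_prob \<alpha> X m"
  then show "strongly_ergodic \<alpha> m"
    by (rule strongly_ergodic_transitive_action[OF assms])
qed

end
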